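(* Let $\varepsilon\in\mathbb{F}\setminus\{0\}$ and $k\in\mathbb{N}\setminus\{0\}$. For $a\in\mathbb{F}(\alpha_1,\ldots,\alpha_{n-1})[\alpha_n]$, write $a=\sum_{i=0}^{\ell}a_i\alpha_n^i$ with $a_i\in\mathbb{F}(\alpha_1,\ldots,\alpha_{n-1})$. Then there exists $g\in\mathbb{F}(\alpha_1,\ldots,\alpha_{n-1})[\alpha_n]$ with $\deg_{\alpha_n}(g)\le\deg_{\alpha_n}(a)$ and $a=\varepsilon\sigma^k(g)-g$ if and only if, for each $i$ with $0\le i\le\ell$, $a_i$ is $\varepsilon_i'\sigma^k$-summable in $\mathbb{F}(\alpha_1,\ldots,\alpha_{n-1})$, where $\varepsilon_i'=\varepsilon\lambda_n^{ki}$.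
   Context: $\mathbb{F}$ is a subfield of $\overline{\mathbb{Q}}$, $n\ge1$, $\lambda_1,\ldots,\lambda_n\in\mathbb{F}\setminus\{0\}$, and $\sigma$ is the field automorphism of the rational function field $\mathbb{F}(\alpha_1,\ldots,\alpha_n)$ with $\sigma|_{\mathbb{F}}=\mathrm{id}$ and $\sigma(\alpha_i)=\lambda_i\alpha_i$. For $n=1$, $\mathbb{F}(\alpha_1,\ldots,\alpha_{n-1})$ means $\mathbb{F}$. The degree of the zero polynomial is $-\infty$. For $e\in\mathbb{F}\setminus\{0\}$, an element $h\in\mathbb{F}(\alpha_1,\ldots,\alpha_{n-1})$ is $e\sigma^k$-summable in $\mathbb{F}(\alpha_1,\ldots,\alpha_{n-1})$ if $h=e\sigma^k(v)-v$ for some $v\in\mathbb{F}(\alpha_1,\ldots,\alpha_{n-1})$. *)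

theory Defs
  imports
    "HOL-Algebra.Algebraic_Closure_Type"
    "HOL-Library.Poly_Mapping"
    "HOL-Library.Extended_Real"
begin

text \<open>
  Polynomials in the variables \<open>\<alpha>\<^sub>1, \<alpha>\<^sub>2, \<dots>\<close> are finitely supported maps from monomials
  to coefficients, a monomial being a finitely supported exponent function. For a subfield \<open>F\<close> of
  the complex numbers, \<open>F(\<alpha>\<^sub>1,\<dots>,\<alpha>\<^sub>m)\<close> is the set \<open>ratfuns F m\<close> inside the fraction field of all
  complex polynomials; \<open>ratfuns F 0\<close> consists of the constants from \<open>F\<close>.
\<close>

type_synonym mpoly = "(nat \<Rightarrow>\<^sub>0 nat) \<Rightarrow>\<^sub>0 complex"
type_synonym ratfun = "mpoly fract"

definition mpolys :: "complex set \<Rightarrow> nat \<Rightarrow> mpoly set" where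
  "mpolys F m = {p. range (Poly_Mapping.lookup p) \<subseteq> F \<and>
                    (\<forall>t \<in> Poly_Mapping.keys p. Poly_Mapping.keys t \<subseteq> {1..m})}"

definition ratfuns :: "complex set \<Rightarrow> nat \<Rightarrow> ratfun set" where
  "ratfuns F m = {Fract p q | p q. p \<in> mpolys F m \<and> q \<in> mpolys F m \<and> q \<noteq> 0}"

definition ratconst :: "complex \<Rightarrow> ratfun" where
  "ratconst c = Fract (Poly_Mapping.single 0 c) 1"

definition ratvar :: "nat \<Rightarrow> ratfun" where
  "ratvar i = Fract (Poly_Mapping.single (Poly_Mapping.single i 1) 1) 1"

text \<open>
  Since \<open>ring_iso\<close> only constrains a map on the carrier, the values of a member of
  \<open>field_auts L\<close> outside of \<open>L\<close> are irrelevant.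
\<close>

definition field_auts :: "'a::field set \<Rightarrow> ('a \<Rightarrow> 'a) set" where
  "field_auts L = ring_iso (ring_of_type_algebra\<lparr>carrier := L\<rparr>) (ring_of_type_algebra\<lparr>carrier := L\<rparr>)"

definition polys_over :: "'a::field set \<Rightarrow> 'a poly set" where
  "polys_over K = {p. range (Polynomial.coeff p) \<subseteq> K}"

definition poly_elems :: "'a::field set \<Rightarrow> 'a \<Rightarrow> 'a set" where
  "poly_elems K x = (\<lambda>p. poly p x) ` polys_over K"

text \<open>
  The degree in \<open>x\<close> of an element of \<open>K[x]\<close>; it is meaningful when \<open>x\<close> is transcendental over \<open>K\<close>,
  so that the polynomial representing the element is unique. For \<open>K = F(\<alpha>\<^sub>1,\<dots>,\<alpha>\<^sub>m)\<close> and
  \<open>x = \<alpha>\<^sub>n\<close> with \<open>m < n\<close> this is lemma \<open>inj_on_poly_ratvar\<close> below.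
\<close>

definition deg_over :: "'a::field set \<Rightarrow> 'a \<Rightarrow> 'a \<Rightarrow> ereal" where
  "deg_over K x f =
     (if f = 0 then -\<infinity>
      else ereal (real (Polynomial.degree (THE p. p \<in> polys_over K \<and> poly p x = f))))"

definition summable_in :: "ratfun set \<Rightarrow> (ratfun \<Rightarrow> ratfun) \<Rightarrow> nat \<Rightarrow> complex \<Rightarrow> ratfun \<Rightarrow> bool" where
  "summable_in K \<sigma> k e h \<longleftrightarrow> (\<exists>v\<in>K. h = ratconst e * (\<sigma> ^^ k) v - v)"

lemma mpolys_mult:
  assumes "p \<in> mpolys UNIV m" "q \<in> mpolys UNIV m"
  shows "p * q \<in> mpolys UNIV m"
proof -
  have "Poly_Mapping.keys t \<subseteq> {1..m}" if t: "t \<in> Poly_Mapping.keys (p * q)" for t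
  proof -
    obtain u v where uv: "u \<in> Poly_Mapping.keys p" "v \<in> Poly_Mapping.keys q" "t = u + v"
      using keys_mult[of p q] t by blast
    have "Poly_Mapping.keys t \<subseteq> Poly_Mapping.keys u \<union> Poly_Mapping.keys v"
      using uv(3) keys_add[of u v] by simp
    then show ?thesis using uv(1,2) assms unfolding mpolys_def by blast
  qed
  then show ?thesis by (auto simp: mpolys_def)
qed

lemma mpolys_add:
  assumes "p \<in> mpolys UNIV m" "q \<in> mpolys UNIV m"
  shows "p + q \<in> mpolys UNIV m"
  using assms keys_add[of p q] unfolding mpolys_def by blast

lemma mpolys_uminus: "p \<in> mpolys UNIV m \<Longrightarrow> - p \<in> mpolys UNIV m"
  by (simp add: mpolys_def)

lemma mpolys_one: "1 \<in> mpolys UNIV m"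
  by (simp add: mpolys_def flip: single_one)

lemma ratfuns_diff:
  assumes "f \<in> ratfuns UNIV m" "g \<in> ratfuns UNIV m"
  shows "f - g \<in> ratfuns UNIV m"
proof -
  obtain p q r s where *: "f = Fract p q" "g = Fract r s" "q \<noteq> 0" "s \<noteq> 0"
    "p \<in> mpolys UNIV m" "q \<in> mpolys UNIV m" "r \<in> mpolys UNIV m" "s \<in> mpolys UNIV m"
    using assms unfolding ratfuns_def by blast
  have "p * s + - (r * q) \<in> mpolys UNIV m" "q * s \<in> mpolys UNIV m"
    by (intro mpolys_mult mpolys_add mpolys_uminus *)+
  moreover have "f - g = Fract (p * s + - (r * q)) (q * s)"
    using * by simp
  ultimately show ?thesis using * unfolding ratfuns_def by fastforce
qed

lemma sum_single_lookup:
  fixes f :: mpoly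
  shows "(\<Sum>t \<in> Poly_Mapping.keys f. Poly_Mapping.single t (Poly_Mapping.lookup f t)) = f"
proof (rule poly_mapping_eqI)
  fix u
  show "Poly_Mapping.lookup (\<Sum>t \<in> Poly_Mapping.keys f. Poly_Mapping.single t (Poly_Mapping.lookup f t)) u
      = Poly_Mapping.lookup f u"
    by (simp add: lookup_sum lookup_single when_def in_keys_iff)
qed

lemma lookup_times_single:
  fixes f :: mpoly
  shows "Poly_Mapping.lookup (f * Poly_Mapping.single s 1) u =
         (\<Sum>t \<in> Poly_Mapping.keys f. Poly_Mapping.lookup f t when t + s = u)"
proof -
  have "f * Poly_Mapping.single s 1 =
      (\<Sum>t \<in> Poly_Mapping.keys f. Poly_Mapping.single t (Poly_Mapping.lookup f t)) * Poly_Mapping.single s 1"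
    by (simp add: sum_single_lookup)
  also have "\<dots> = (\<Sum>t \<in> Poly_Mapping.keys f. Poly_Mapping.single (t + s) (Poly_Mapping.lookup f t))"
    by (simp add: sum_distrib_right mult_single)
  finally show ?thesis by (simp add: lookup_sum lookup_single)
qed

lemma common_denominator:
  assumes "finite I" "\<And>i. i \<in> I \<Longrightarrow> f i \<in> ratfuns UNIV m"
  shows "\<exists>D r. D \<in> mpolys UNIV m \<and> D \<noteq> 0 \<and> (\<forall>i\<in>I. r i \<in> mpolys UNIV m \<and> f i = Fract (r i) D)"
  using assms
proof (induction I rule: finite_induct)
  case empty
  show ?case using mpolys_one by (intro exI[of _ 1]) simp
next
  case (insert j I)
  then obtain D r where D: "D \<in> mpolys UNIV m" "D \<noteq> 0"
    and r: "\<And>i. i \<in> I \<Longrightarrow> r i \<in> mpolys UNIV m" "\<And>i. i \<in> I \<Longrightarrow> f i = Fract (r i) D"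
    by auto
  obtain p q where pq: "p \<in> mpolys UNIV m" "q \<in> mpolys UNIV m" "q \<noteq> 0" "f j = Fract p q"
    using insert.prems[of j] unfolding ratfuns_def by auto
  define r' where "r' i = (if i = j then p * D else r i * q)" for i
  have "r' i \<in> mpolys UNIV m \<and> f i = Fract (r' i) (D * q)" if "i \<in> insert j I" for i
    using that D r pq insert.hyps by (auto simp: r'_def eq_fract algebra_simps intro!: mpolys_mult)
  moreover have "D * q \<in> mpolys UNIV m" "D * q \<noteq> 0"
    using D pq by (auto intro: mpolys_mult)
  ultimately show ?case by blast
qed

lemma ratvar_power: "ratvar n ^ i = Fract (Poly_Mapping.single (Poly_Mapping.single n i) 1) 1"
proof (induction i)
  case 0
  show ?case by (simp add: One_fract_def)
next
  case (Suc i)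
  then show ?case by (simp add: ratvar_def mult_single flip: single_add)
qed

lemma sum_Fract:
  assumes "finite I" "D \<noteq> 0"
  shows "(\<Sum>i\<in>I. Fract (r i) D) = Fract (\<Sum>i\<in>I. r i) D"
  using assms(1)
proof (induction I rule: finite_induct)
  case empty
  show ?case using assms(2) by (simp add: Zero_fract_def eq_fract)
next
  case (insert i I)
  then show ?case using assms(2) by (simp add: eq_fract algebra_simps)
qed

lemma ratvar_transcendental:
  assumes "m < n" "p \<in> polys_over (ratfuns UNIV m)" "poly p (ratvar n) = 0"
  shows "p = 0"
proof -
  define J where "J = {..Polynomial.degree p}"
  have "Polynomial.coeff p i \<in> ratfuns UNIV m" for i
    using assms(2) by (auto simp: polys_over_def)
  then obtain D r where D: "D \<noteq> 0" and r: "\<And>i. i \<in> J \<Longrightarrow> r i \<in> mpolys UNIV m"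
    "\<And>i. i \<in> J \<Longrightarrow> Polynomial.coeff p i = Fract (r i) D"
    using common_denominator[of J "Polynomial.coeff p" m] by (auto simp: J_def)
  define mon :: "nat \<Rightarrow> mpoly" where "mon i = Poly_Mapping.single (Poly_Mapping.single n i) 1" for i
  have "poly p (ratvar n) = (\<Sum>i\<in>J. Fract (r i * mon i) D)"
    unfolding poly_altdef J_def[symmetric]
    by (rule sum.cong) (simp_all add: r ratvar_power mon_def)
  also have "\<dots> = Fract (\<Sum>i\<in>J. r i * mon i) D"
    by (rule sum_Fract) (simp_all add: J_def D)
  finally have z: "(\<Sum>i\<in>J. r i * mon i) = 0"
    using assms(3) D by (simp add: Zero_fract_def eq_fract)
  have n0: "Poly_Mapping.lookup t n = 0" if "i \<in> J" "t \<in> Poly_Mapping.keys (r i)" for i t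
    using r(1)[OF that(1)] that(2) assms(1) unfolding mpolys_def
    by (force simp: in_keys_iff)
  have "r j = 0" if j: "j \<in> J" for j
  proof (rule ccontr)
    assume "r j \<noteq> 0"
    then obtain t where t: "t \<in> Poly_Mapping.keys (r j)" by fastforce
    have eq: "t' + Poly_Mapping.single n i = t + Poly_Mapping.single n j \<longleftrightarrow> i = j \<and> t' = t"
      if "i \<in> J" "t' \<in> Poly_Mapping.keys (r i)" for i t'
    proof
      assume *: "t' + Poly_Mapping.single n i = t + Poly_Mapping.single n j"
      have "Poly_Mapping.lookup (t' + Poly_Mapping.single n i) n =
            Poly_Mapping.lookup (t + Poly_Mapping.single n j) n"
        using * by simp
      then have "i = j" using n0[OF that] n0[OF j t] by (simp add: lookup_add)
      then show "i = j \<and> t' = t" using * by simp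
    qed simp
    have "0 = Poly_Mapping.lookup (\<Sum>i\<in>J. r i * mon i) (t + Poly_Mapping.single n j)"
      using z by simp
    also have "\<dots> = (\<Sum>i\<in>J. \<Sum>t'\<in>Poly_Mapping.keys (r i).
        Poly_Mapping.lookup (r i) t' when t' + Poly_Mapping.single n i = t + Poly_Mapping.single n j)"
      by (simp add: lookup_sum mon_def lookup_times_single)
    also have "\<dots> = (\<Sum>i\<in>J. \<Sum>t'\<in>Poly_Mapping.keys (r i).
        if i = j then (if t' = t then Poly_Mapping.lookup (r i) t' else 0) else 0)"
      by (intro sum.cong refl) (auto simp: eq when_def)
    also have "\<dots> = (\<Sum>i\<in>J. if i = j then (\<Sum>t'\<in>Poly_Mapping.keys (r i).
        if t' = t then Poly_Mapping.lookup (r i) t' else 0) else 0)"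
      by (intro sum.cong refl) auto
    also have "\<dots> = Poly_Mapping.lookup (r j) t"
      using j t by (simp add: J_def)
    finally show False using t by (simp add: in_keys_iff)
  qed
  then have "Polynomial.coeff p i = 0" if "i \<in> J" for i
    using that r(2)[OF that] D by (simp add: Zero_fract_def eq_fract)
  from this[of "Polynomial.degree p"] show ?thesis
    by (simp add: J_def)
qed

lemma inj_on_poly_ratvar:
  assumes "m < n"
  shows "inj_on (\<lambda>p. poly p (ratvar n)) (polys_over (ratfuns F m))"
proof (rule inj_onI)
  fix p q
  assume pq: "p \<in> polys_over (ratfuns F m)" "q \<in> polys_over (ratfuns F m)"
    and e: "poly p (ratvar n) = poly q (ratvar n)"
  have "ratfuns F m \<subseteq> ratfuns UNIV m"
    unfolding ratfuns_def mpolys_def by blast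
  then have "p - q \<in> polys_over (ratfuns UNIV m)"
    using pq unfolding polys_over_def by (auto intro!: ratfuns_diff)
  moreover have "poly (p - q) (ratvar n) = 0" using e by simp
  ultimately show "p = q" using ratvar_transcendental[OF assms] by fastforce
qed

end

theory Submission
  imports Defs
begin

text \<open>
  Put \<open>K = F(\<alpha>\<^sub>1,\<dots>,\<alpha>\<^sub>n\<^sub>-\<^sub>1)\<close>, \<open>x = \<alpha>\<^sub>n\<close>, \<open>\<tau> = \<sigma>\<^sup>k\<close> and \<open>\<mu> = \<lambda>\<^sub>n\<^sup>k\<close>, so that \<open>\<tau> x = \<mu> x\<close>.
  Since \<open>\<tau>\<close> is a ring homomorphism that maps \<open>K\<close> into itself, the operator
  \<open>g \<mapsto> \<epsilon> \<tau>(g) - g\<close> acts diagonally on the powers of \<open>x\<close>: it sends \<open>\<Sum>\<^sub>i v\<^sub>i x\<^sup>i\<close> to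
  \<open>\<Sum>\<^sub>i (\<epsilon> \<mu>\<^sup>i \<tau>(v\<^sub>i) - v\<^sub>i) x\<^sup>i\<close>. As \<open>x\<close> is transcendental over \<open>K\<close>, coefficients can be compared,
  and the equation \<open>a = \<epsilon> \<tau>(g) - g\<close> splits into one summability equation for each \<open>a\<^sub>i\<close>.
  Conversely, solutions \<open>v\<^sub>i\<close> are assembled into \<open>g\<close>; choosing \<open>v\<^sub>i = 0\<close> whenever \<open>a\<^sub>i = 0\<close> gives
  the degree bound. Lemma \<open>skew_difference_coeffwise\<close> is this argument for arbitrary fields.

  What is special to rational functions is that \<open>\<sigma>\<close> maps \<open>K\<close> into itself. By lemma
  \<open>ratfuns_least\<close>, \<open>K\<close> is contained in every subfield that contains the constants from \<open>F\<close> and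
  \<open>\<alpha>\<^sub>1,\<dots>,\<alpha>\<^sub>n\<^sub>-\<^sub>1\<close>; the elements that \<open>\<sigma>\<close> maps into \<open>K\<close> form such a subfield.
\<close>

section \<open>Subfields of a field type\<close>

lemma subfield_zero_closed:
  assumes "subfield S (ring_of_type_algebra :: 'a::field ring)"
  shows "0 \<in> S"
  using subdomainE(2)[OF subfield.axioms(1)[OF assms]] by (simp add: ring_of_type_algebra_def)

lemma subfield_one_closed:
  assumes "subfield S (ring_of_type_algebra :: 'a::field ring)"
  shows "1 \<in> S"
  using subdomainE(3)[OF subfield.axioms(1)[OF assms]] by (simp add: ring_of_type_algebra_def)

lemma subfield_add_closed:
  assumes "subfield S (ring_of_type_algebra :: 'a::field ring)" "x \<in> S" "y \<in> S"
  shows "x + y \<in> S"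
  using subdomainE(7)[OF subfield.axioms(1)[OF assms(1)]] assms(2,3)
  by (simp add: ring_of_type_algebra_def)

lemma subfield_mult_closed:
  assumes "subfield S (ring_of_type_algebra :: 'a::field ring)" "x \<in> S" "y \<in> S"
  shows "x * y \<in> S"
  using subdomainE(6)[OF subfield.axioms(1)[OF assms(1)]] assms(2,3)
  by (simp add: ring_of_type_algebra_def)

lemma subfield_inverse_closed:
  assumes S: "subfield S (ring_of_type_algebra :: 'a::field ring)" and x: "x \<in> S"
  shows "inverse x \<in> S"
proof (cases "x = 0")
  case False
  then have "x \<in> Units ((ring_of_type_algebra :: 'a ring)\<lparr>carrier := S\<rparr>)"
    using subfield.subfield_Units[OF S] x by (simp add: ring_of_type_algebra_def)
  then obtain y where "y \<in> S" "y * x = 1"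
    unfolding Units_def by (auto simp: ring_of_type_algebra_def)
  then show ?thesis by (metis inverse_unique mult.commute)
qed (use x in simp)

lemma subfield_uminus_closed:
  assumes S: "subfield S (ring_of_type_algebra :: 'a::field ring)" and x: "x \<in> S"
  shows "- x \<in> S"
proof -
  interpret A: ring "ring_of_type_algebra :: 'a ring" by (rule ring_from_type_algebra)
  have "\<ominus>\<^bsub>ring_of_type_algebra\<^esub> x \<in> S"
    using subdomainE(5)[OF subfield.axioms(1)[OF S] x] .
  moreover have "x \<oplus>\<^bsub>ring_of_type_algebra\<^esub> (\<ominus>\<^bsub>ring_of_type_algebra\<^esub> x) = \<zero>\<^bsub>ring_of_type_algebra\<^esub>"
    by (rule A.r_neg) (simp add: ring_of_type_algebra_def)
  then have "\<ominus>\<^bsub>ring_of_type_algebra\<^esub> x = - x"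
    by (simp add: ring_of_type_algebra_def add_eq_0_iff)
  ultimately show ?thesis by simp
qed

lemma subfield_diff_closed:
  assumes "subfield S (ring_of_type_algebra :: 'a::field ring)" "x \<in> S" "y \<in> S"
  shows "x - y \<in> S"
  using subfield_add_closed[OF assms(1,2) subfield_uminus_closed[OF assms(1,3)]] by simp

lemma subfield_power_closed:
  assumes "subfield S (ring_of_type_algebra :: 'a::field ring)" "x \<in> S"
  shows "x ^ i \<in> S"
  using assms by (induction i) (auto intro: subfield_one_closed subfield_mult_closed)

lemma subfield_sum_closed:
  assumes "subfield S (ring_of_type_algebra :: 'a::field ring)" "\<And>i. i \<in> I \<Longrightarrow> f i \<in> S"
  shows "(\<Sum>i\<in>I. f i) \<in> S"
  using assms(2)
  by (induction I rule: infinite_finite_induct)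
     (auto intro: subfield_zero_closed[OF assms(1)] subfield_add_closed[OF assms(1)])

lemma subfield_prod_closed:
  assumes "subfield S (ring_of_type_algebra :: 'a::field ring)" "\<And>i. i \<in> I \<Longrightarrow> f i \<in> S"
  shows "(\<Prod>i\<in>I. f i) \<in> S"
  using assms(2)
  by (induction I rule: infinite_finite_induct)
     (auto intro: subfield_one_closed[OF assms(1)] subfield_mult_closed[OF assms(1)])

lemmas subfield_closed =
  subfield_zero_closed subfield_one_closed subfield_add_closed subfield_uminus_closed
  subfield_diff_closed subfield_mult_closed subfield_inverse_closed subfield_power_closed
  subfield_sum_closed subfield_prod_closed

lemma subfield_of_typeI:
  fixes S :: "'a::field set"
  assumes one: "1 \<in> S"
    and uminus: "\<And>x. x \<in> S \<Longrightarrow> - x \<in> S"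
    and add: "\<And>x y. x \<in> S \<Longrightarrow> y \<in> S \<Longrightarrow> x + y \<in> S"
    and mult: "\<And>x y. x \<in> S \<Longrightarrow> y \<in> S \<Longrightarrow> x * y \<in> S"
    and inverse: "\<And>x. x \<in> S \<Longrightarrow> x \<noteq> 0 \<Longrightarrow> inverse x \<in> S"
  shows "subfield S (ring_of_type_algebra :: 'a ring)"
proof -
  let ?R = "ring_of_type_algebra :: 'a ring"
  interpret A: field ?R by (rule field_from_type_algebra)
  have uminus_eq: "\<ominus>\<^bsub>?R\<^esub> x = - x" for x
    using A.r_neg[of x] by (simp add: ring_of_type_algebra_def add_eq_0_iff)
  have inverse_eq: "inv\<^bsub>?R\<^esub> x = inverse x" if "x \<noteq> 0" for x
  proof (rule A.comm_inv_char)
    show "x \<otimes>\<^bsub>?R\<^esub> inverse x = \<one>\<^bsub>?R\<^esub>"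
      using that by (simp add: ring_of_type_algebra_def)
  qed (simp_all add: ring_of_type_algebra_def)
  show ?thesis
  proof (rule A.subfieldI')
    show "subring S ?R"
      by (rule A.subringI) (use assms uminus_eq in \<open>auto simp: ring_of_type_algebra_def\<close>)
    show "inv\<^bsub>?R\<^esub> x \<in> S" if "x \<in> S - {\<zero>\<^bsub>?R\<^esub>}" for x
    proof -
      have "x \<noteq> 0" using that by (simp add: ring_of_type_algebra_def)
      with that inverse show ?thesis by (simp add: inverse_eq)
    qed
  qed
qed

section \<open>Field automorphisms\<close>

lemma
  assumes "\<tau> \<in> field_auts L"
  shows field_auts_closed: "x \<in> L \<Longrightarrow> \<tau> x \<in> L"
    and field_auts_add: "x \<in> L \<Longrightarrow> y \<in> L \<Longrightarrow> \<tau> (x + y) = \<tau> x + \<tau> y"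
    and field_auts_mult: "x \<in> L \<Longrightarrow> y \<in> L \<Longrightarrow> \<tau> (x * y) = \<tau> x * \<tau> y"
    and field_auts_one: "\<tau> 1 = 1"
  using assms unfolding field_auts_def ring_iso_def
  by (auto simp: ring_hom_def ring_of_type_algebra_def)

lemma field_auts_funpow:
  assumes "\<sigma> \<in> field_auts L"
  shows "\<sigma> ^^ k \<in> field_auts L"
proof (induction k)
  case 0
  show ?case
    by (auto simp: field_auts_def ring_iso_def ring_hom_def ring_of_type_algebra_def bij_betw_def)
next
  case (Suc k)
  show ?case
    unfolding field_auts_def funpow.simps
    by (rule ring_iso_set_trans) (use Suc.IH assms in \<open>simp_all add: field_auts_def\<close>)
qed

context
  fixes L :: "'a::field set" and \<tau> :: "'a \<Rightarrow> 'a"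
  assumes L: "subfield L (ring_of_type_algebra :: 'a ring)"
    and \<tau>: "\<tau> \<in> field_auts L"
begin

lemma field_auts_zero: "\<tau> 0 = 0"
  using field_auts_add[OF \<tau>, of 0 0] subfield_zero_closed[OF L]
  by (metis add.right_neutral add_left_cancel)

lemma field_auts_uminus:
  assumes "x \<in> L"
  shows "\<tau> (- x) = - \<tau> x"
  using field_auts_add[OF \<tau>, of x "- x"] assms subfield_uminus_closed[OF L] field_auts_zero
  by (simp add: eq_neg_iff_add_eq_0 add.commute)

lemma field_auts_inverse:
  assumes "x \<in> L"
  shows "\<tau> (inverse x) = inverse (\<tau> x)"
proof (cases "x = 0")
  case False
  then have "\<tau> x * \<tau> (inverse x) = 1"
    using field_auts_mult[OF \<tau>, of x "inverse x"] assms subfield_inverse_closed[OF L]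
      field_auts_one[OF \<tau>] by simp
  then show ?thesis by (metis inverse_unique)
qed (simp add: field_auts_zero)

text \<open>
  The preimage of a subfield is a subfield, so whether \<open>\<tau>\<close> maps a field into \<open>K\<close> can be tested
  on field generators.
\<close>

lemma subfield_preimage:
  assumes K: "subfield K (ring_of_type_algebra :: 'a ring)"
  shows "subfield {x \<in> L. \<tau> x \<in> K} (ring_of_type_algebra :: 'a ring)"
  by (rule subfield_of_typeI)
     (auto simp: field_auts_one[OF \<tau>] field_auts_uminus field_auts_add[OF \<tau>]
        field_auts_mult[OF \<tau>] field_auts_inverse intro!: subfield_closed[OF L] subfield_closed[OF K])

end

section \<open>The operator on polynomial expressions\<close>

lemma polys_over_coeff: "p \<in> polys_over K \<Longrightarrow> coeff p i \<in> K"
  by (auto simp: polys_over_def)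

lemma poly_in_subfield:
  assumes "subfield L (ring_of_type_algebra :: 'a::field ring)" "p \<in> polys_over L" "x \<in> L"
  shows "poly p x \<in> L"
  unfolding poly_altdef using assms
  by (intro subfield_sum_closed subfield_mult_closed subfield_power_closed polys_over_coeff)

lemma field_auts_poly:
  assumes L: "subfield L (ring_of_type_algebra :: 'a::field ring)" and \<tau>: "\<tau> \<in> field_auts L"
    and x: "x \<in> L" and "p \<in> polys_over L"
  shows "\<tau> (poly p x) = poly (map_poly \<tau> p) (\<tau> x)"
  using assms(4)
proof (induction p)
  case 0
  show ?case by (simp add: field_auts_zero[OF L \<tau>])
next
  case (pCons a p)
  have a: "a \<in> L" using polys_over_coeff[OF pCons.prems, of 0] by simp
  have "coeff p i \<in> L" for i using polys_over_coeff[OF pCons.prems, of "Suc i"] by simp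
  then have p: "p \<in> polys_over L" by (auto simp: polys_over_def)
  have "poly p x \<in> L" by (rule poly_in_subfield[OF L p x])
  then show ?case
    using a x pCons.IH[OF p] subfield_mult_closed[OF L]
    by (simp add: map_poly_pCons field_auts_zero[OF L \<tau>] field_auts_add[OF \<tau>] field_auts_mult[OF \<tau>])
qed

text \<open>
  This is the map that \<open>\<tau>\<close> induces on \<open>K[x]\<close> when \<open>\<tau> x = \<mu> x\<close>, written as a map on polynomials so
  that its coefficients can be read off: \<open>\<tau>\<close> is applied to the coefficients and \<open>\<mu> x\<close> is
  substituted for \<open>x\<close>.
\<close>

definition poly_shift :: "('a::field \<Rightarrow> 'a) \<Rightarrow> 'a \<Rightarrow> 'a poly \<Rightarrow> 'a poly" where
  "poly_shift \<tau> \<mu> p = pcompose (map_poly \<tau> p) [:0, \<mu>:]"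

lemma coeff_poly_shift:
  "\<tau> 0 = 0 \<Longrightarrow> coeff (poly_shift \<tau> \<mu> p) i = \<mu> ^ i * \<tau> (coeff p i)"
  by (simp add: poly_shift_def coeff_pcompose_linear coeff_map_poly)

lemma poly_poly_shift:
  assumes "subfield L (ring_of_type_algebra :: 'a::field ring)" "\<tau> \<in> field_auts L"
    "x \<in> L" "p \<in> polys_over L" "\<tau> x = \<mu> * x"
  shows "poly (poly_shift \<tau> \<mu> p) x = \<tau> (poly p x)"
  using field_auts_poly[OF assms(1-4)] assms(5)
  by (simp add: poly_shift_def poly_pcompose mult.commute)

text \<open>
  Injectivity of evaluation at \<open>x\<close> makes the definite description in the definition of
  \<^const>\<open>deg_over\<close> denote \<open>p\<close>.
\<close>

lemma deg_over_poly:
  assumes inj: "inj_on (\<lambda>p. poly p x) (polys_over K)" and p: "p \<in> polys_over K" and "0 \<in> K"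
  shows "deg_over K x (poly p x) = (if p = 0 then -\<infinity> else ereal (real (degree p)))"
proof -
  have "0 \<in> polys_over K" using \<open>0 \<in> K\<close> by (auto simp: polys_over_def)
  then have "poly p x = 0 \<longleftrightarrow> p = 0"
    using inj_onD[OF inj, of p 0] p by auto
  moreover have "(THE q. q \<in> polys_over K \<and> poly q x = poly p x) = p"
    using inj_onD[OF inj] p by (intro the_equality) auto
  ultimately show ?thesis by (simp add: deg_over_def)
qed

lemma deg_over_poly_mono:
  assumes "inj_on (\<lambda>p. poly p x) (polys_over K)" "p \<in> polys_over K" "q \<in> polys_over K" "0 \<in> K"
    and supp: "\<And>i. coeff p i = 0 \<Longrightarrow> coeff q i = 0"
  shows "deg_over K x (poly q x) \<le> deg_over K x (poly p x)"
proof -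
  have "degree q \<le> degree p"
    by (rule degree_le) (simp add: supp coeff_eq_0)
  moreover have "p = 0 \<Longrightarrow> q = 0"
    by (rule poly_eqI) (simp add: supp)
  ultimately show ?thesis using assms(1-4) by (simp add: deg_over_poly)
qed

text \<open>
  On coefficients, \<open>g \<mapsto> e \<tau>(g) - g\<close> is the operator \<open>\<Delta>\<close> of the proof, which does not mix
  different powers of \<open>x\<close>. Injectivity of evaluation at \<open>x\<close> turns an equation between elements of
  \<open>K[x]\<close> into equations between coefficients.
\<close>

lemma skew_difference_coeffwise:
  fixes K L :: "'a::field set"
  assumes L: "subfield L (ring_of_type_algebra :: 'a ring)"
    and K: "subfield K (ring_of_type_algebra :: 'a ring)" and "K \<subseteq> L"
    and \<tau>: "\<tau> \<in> field_auts L" and \<tau>K: "\<tau> ` K \<subseteq> K"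
    and x: "x \<in> L" and \<tau>x: "\<tau> x = \<mu> * x" and "\<mu> \<in> K" and "e \<in> K"
    and inj: "inj_on (\<lambda>p. poly p x) (polys_over K)"
    and p: "p \<in> polys_over K"
  shows "(\<exists>g \<in> poly_elems K x. deg_over K x g \<le> deg_over K x (poly p x) \<and>
             poly p x = e * \<tau> g - g)
     \<longleftrightarrow> (\<forall>i. \<exists>v\<in>K. coeff p i = e * \<mu> ^ i * \<tau> v - v)"
proof -
  define \<Delta> where "\<Delta> q = smult e (poly_shift \<tau> \<mu> q) - q" for q
  have coeff_\<Delta>: "coeff (\<Delta> q) i = e * \<mu> ^ i * \<tau> (coeff q i) - coeff q i" for q i
    by (simp add: \<Delta>_def coeff_poly_shift field_auts_zero[OF L \<tau>])
  have poly_\<Delta>: "poly (\<Delta> q) x = e * \<tau> (poly q x) - poly q x" if "q \<in> polys_over K" for q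
  proof -
    have "q \<in> polys_over L" using that \<open>K \<subseteq> L\<close> by (auto simp: polys_over_def)
    then show ?thesis by (simp add: \<Delta>_def poly_poly_shift[OF L \<tau> x _ \<tau>x])
  qed
  have \<Delta>_closed: "\<Delta> q \<in> polys_over K" if "q \<in> polys_over K" for q
    using \<tau>K polys_over_coeff[OF that] \<open>e \<in> K\<close> \<open>\<mu> \<in> K\<close>
    by (auto simp: polys_over_def coeff_\<Delta> intro!: subfield_closed[OF K])
  show ?thesis
  proof (intro iffI allI)
    fix i
    assume "\<exists>g \<in> poly_elems K x. deg_over K x g \<le> deg_over K x (poly p x) \<and>
             poly p x = e * \<tau> g - g"
    then obtain q where q: "q \<in> polys_over K" "poly p x = poly (\<Delta> q) x"
      by (auto simp: poly_elems_def poly_\<Delta>)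
    then have "p = \<Delta> q" using inj_onD[OF inj] p \<Delta>_closed by blast
    then show "\<exists>v\<in>K. coeff p i = e * \<mu> ^ i * \<tau> v - v"
      using coeff_\<Delta> polys_over_coeff[OF q(1)] by auto
  next
    assume "\<forall>i. \<exists>v\<in>K. coeff p i = e * \<mu> ^ i * \<tau> v - v"
    then obtain v where v: "\<And>i. v i \<in> K" "\<And>i. coeff p i = e * \<mu> ^ i * \<tau> (v i) - v i"
      by metis
    \<comment> \<open>Replacing solutions of the homogeneous equations by 0 makes the support finite and
        contained in that of \<open>p\<close>, hence bounds the degree.\<close>
    define w where "w i = (if coeff p i = 0 then 0 else v i)" for i
    define q where "q = Abs_poly w"
    have "\<forall>\<^sub>\<infinity>i. w i = 0"
      using MOST_coeff_eq_0[of p] by (rule MOST_mono) (simp add: w_def)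
    then have coeff_q: "coeff q i = w i" for i
      by (simp add: q_def Abs_poly_inverse)
    have q: "q \<in> polys_over K"
      using v(1) subfield_zero_closed[OF K] by (auto simp: polys_over_def coeff_q w_def)
    have "p = \<Delta> q"
      by (rule poly_eqI) (use v(2) in \<open>auto simp: coeff_\<Delta> coeff_q w_def field_auts_zero[OF L \<tau>]\<close>)
    then have "poly p x = e * \<tau> (poly q x) - poly q x"
      using poly_\<Delta>[OF q] by simp
    moreover have "deg_over K x (poly q x) \<le> deg_over K x (poly p x)"
      by (rule deg_over_poly_mono[OF inj p q subfield_zero_closed[OF K]])
         (simp add: coeff_q w_def)
    ultimately show "\<exists>g \<in> poly_elems K x. deg_over K x g \<le> deg_over K x (poly p x) \<and>
             poly p x = e * \<tau> g - g"
      using q by (auto simp: poly_elems_def)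
  qed
qed

section \<open>Rational functions as a generated field\<close>

lemma ratconst_one: "ratconst 1 = 1"
  by (simp add: ratconst_def One_fract_def)

lemma ratconst_mult: "ratconst (x * y) = ratconst x * ratconst y"
  by (simp add: ratconst_def mult_single)

lemma ratconst_power: "ratconst (x ^ i) = ratconst x ^ i"
  by (induction i) (simp_all add: ratconst_one ratconst_mult)

lemma mpolys_lookup: "p \<in> mpolys F m \<Longrightarrow> Poly_Mapping.lookup p t \<in> F"
  by (auto simp: mpolys_def)

lemma mpolys_mono: "F \<subseteq> G \<Longrightarrow> m \<le> n \<Longrightarrow> mpolys F m \<subseteq> mpolys G n"
  unfolding mpolys_def by (fastforce simp: subset_eq)

lemma ratfuns_mono: "F \<subseteq> G \<Longrightarrow> m \<le> n \<Longrightarrow> ratfuns F m \<subseteq> ratfuns G n"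
  using mpolys_mono[of F G m n] unfolding ratfuns_def by blast

text \<open>
  This separates the condition on the variables, whose closure properties are known for complex
  coefficients, from the condition that the coefficients lie in \<open>F\<close>.
\<close>

lemma mpolys_iff_UNIV: "p \<in> mpolys F m \<longleftrightarrow> p \<in> mpolys UNIV m \<and> range (Poly_Mapping.lookup p) \<subseteq> F"
  by (auto simp: mpolys_def)

lemma mpoly_times_altdef:
  fixes p q :: mpoly
  shows "p * q = (\<Sum>s\<in>Poly_Mapping.keys p. \<Sum>t\<in>Poly_Mapping.keys q.
           Poly_Mapping.single (s + t) (Poly_Mapping.lookup p s * Poly_Mapping.lookup q t))"
proof -
  have "p * q = (\<Sum>s\<in>Poly_Mapping.keys p. Poly_Mapping.single s (Poly_Mapping.lookup p s)) *
                (\<Sum>t\<in>Poly_Mapping.keys q. Poly_Mapping.single t (Poly_Mapping.lookup q t))"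
    by (simp only: sum_single_lookup)
  then show ?thesis by (simp add: sum_product mult_single)
qed

context
  fixes F :: "complex set"
  assumes F: "subfield F (ring_of_type_algebra :: complex ring)"
begin

lemma mpolys_over_subfield:
  shows mpolys_single: "z \<in> F \<Longrightarrow> Poly_Mapping.keys t \<subseteq> {1..m} \<Longrightarrow> Poly_Mapping.single t z \<in> mpolys F m"
    and mpolys_subfield_one: "1 \<in> mpolys F m"
    and mpolys_subfield_uminus: "p \<in> mpolys F m \<Longrightarrow> - p \<in> mpolys F m"
    and mpolys_subfield_add: "p \<in> mpolys F m \<Longrightarrow> q \<in> mpolys F m \<Longrightarrow> p + q \<in> mpolys F m"
    and mpolys_subfield_mult: "p \<in> mpolys F m \<Longrightarrow> q \<in> mpolys F m \<Longrightarrow> p * q \<in> mpolys F m"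
proof -
  show single: "Poly_Mapping.single t z \<in> mpolys F m"
    if "z \<in> F" "Poly_Mapping.keys t \<subseteq> {1..m}" for t z
    using that subfield_zero_closed[OF F] by (auto simp: mpolys_def lookup_single when_def)
  show "1 \<in> mpolys F m"
    using single[of 1 0] subfield_one_closed[OF F] by simp
  show "- p \<in> mpolys F m" if "p \<in> mpolys F m"
    using that subfield_uminus_closed[OF F] by (auto simp: mpolys_def)
  assume pq: "p \<in> mpolys F m" "q \<in> mpolys F m"
  then have UNIV: "p \<in> mpolys UNIV m" "q \<in> mpolys UNIV m"
    by (simp_all add: mpolys_iff_UNIV[of _ F])
  show "p + q \<in> mpolys F m"
    using mpolys_add[OF UNIV] pq subfield_add_closed[OF F] mpolys_lookup
    by (auto simp: mpolys_iff_UNIV[of _ F] lookup_add)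
  have "Poly_Mapping.lookup (p * q) u \<in> F" for u
    unfolding mpoly_times_altdef using pq
    by (auto simp: lookup_sum lookup_single when_def mpolys_lookup intro!: subfield_closed[OF F])
  then show "p * q \<in> mpolys F m"
    using mpolys_mult[OF UNIV] by (auto simp: mpolys_iff_UNIV[of _ F])
qed

lemma subfield_ratfuns: "subfield (ratfuns F m) (ring_of_type_algebra :: ratfun ring)"
proof (rule subfield_of_typeI)
  have FractI: "Fract p q \<in> ratfuns F m" if "p \<in> mpolys F m" "q \<in> mpolys F m" "q \<noteq> 0" for p q
    using that unfolding ratfuns_def by blast
  note closed = FractI mpolys_subfield_mult mpolys_subfield_add mpolys_subfield_uminus mpolys_subfield_one
  show "1 \<in> ratfuns F m"
    unfolding One_fract_def by (rule closed)+ simp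
  fix x assume "x \<in> ratfuns F m"
  then obtain p q where x: "x = Fract p q" "p \<in> mpolys F m" "q \<in> mpolys F m" "q \<noteq> 0"
    unfolding ratfuns_def by blast
  show "- x \<in> ratfuns F m" using x by (auto intro: closed)
  show "inverse x \<in> ratfuns F m" if "x \<noteq> 0"
  proof -
    have "p \<noteq> 0" using that x by (auto simp: Zero_fract_def eq_fract)
    then show ?thesis using x by (auto intro: closed)
  qed
  fix y assume "y \<in> ratfuns F m"
  then obtain r s where y: "y = Fract r s" "r \<in> mpolys F m" "s \<in> mpolys F m" "s \<noteq> 0"
    unfolding ratfuns_def by blast
  show "x + y \<in> ratfuns F m" "x * y \<in> ratfuns F m"
    using x y by (auto intro!: closed)
qed

lemma ratconst_in_ratfuns: "z \<in> F \<Longrightarrow> ratconst z \<in> ratfuns F m"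
  using mpolys_single[of z 0 m] mpolys_subfield_one[of m]
  unfolding ratconst_def ratfuns_def by fastforce

lemma ratvar_in_ratfuns: "i \<in> {1..m} \<Longrightarrow> ratvar i \<in> ratfuns F m"
  using mpolys_single[of 1 "Poly_Mapping.single i 1" m] mpolys_subfield_one[of m]
    subfield_one_closed[OF F]
  unfolding ratvar_def ratfuns_def by fastforce

end

lemma Fract_monomial:
  "Fract (Poly_Mapping.single t z) 1 =
     ratconst z * (\<Prod>i\<in>Poly_Mapping.keys t. ratvar i ^ Poly_Mapping.lookup t i)"
proof -
  have prod: "Fract (Poly_Mapping.single (\<Sum>i\<in>I. Poly_Mapping.single i (f i)) 1) 1 =
      (\<Prod>i\<in>I. ratvar i ^ f i)" if "finite I" for I and f :: "nat \<Rightarrow> nat"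
    using that
  proof (induction I rule: finite_induct)
    case (insert i I)
    have "(\<Prod>j\<in>insert i I. ratvar j ^ f j) = ratvar i ^ f i *
        Fract (Poly_Mapping.single (\<Sum>j\<in>I. Poly_Mapping.single j (f j)) 1) 1"
      using insert by simp
    then show ?case
      using insert.hyps by (simp only: ratvar_power mult_fract mult_single sum.insert) simp
  qed (simp add: One_fract_def)
  have "t = (\<Sum>i\<in>Poly_Mapping.keys t. Poly_Mapping.single i (Poly_Mapping.lookup t i))"
    by (rule poly_mapping_eqI) (simp add: lookup_sum lookup_single when_def in_keys_iff)
  then have "Fract (Poly_Mapping.single t 1) 1 =
      (\<Prod>i\<in>Poly_Mapping.keys t. ratvar i ^ Poly_Mapping.lookup t i)"
    using prod[of "Poly_Mapping.keys t" "Poly_Mapping.lookup t"] by simp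
  moreover have "Fract (Poly_Mapping.single t z) 1 = ratconst z * Fract (Poly_Mapping.single t 1) 1"
    by (simp add: ratconst_def mult_single)
  ultimately show ?thesis by simp
qed

text \<open>
  Every element of \<open>F(\<alpha>\<^sub>1,\<dots>,\<alpha>\<^sub>m)\<close> is a quotient of sums of monomials, and a monomial is a product
  of a constant and powers of variables. This serves as an induction principle for
  \<^const>\<open>ratfuns\<close>.
\<close>

lemma ratfuns_least:
  assumes S: "subfield S (ring_of_type_algebra :: ratfun ring)"
    and const: "ratconst ` F \<subseteq> S" and var: "ratvar ` {1..m} \<subseteq> S"
  shows "ratfuns F m \<subseteq> S"
proof
  have poly: "Fract p 1 \<in> S" if p: "p \<in> mpolys F m" for p
  proof -
    have "Fract p 1 = Fract (\<Sum>t\<in>Poly_Mapping.keys p. Poly_Mapping.single t (Poly_Mapping.lookup p t)) 1"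
      by (simp add: sum_single_lookup)
    also have "\<dots> = (\<Sum>t\<in>Poly_Mapping.keys p. Fract (Poly_Mapping.single t (Poly_Mapping.lookup p t)) 1)"
      by (simp add: sum_Fract)
    also have "\<dots> = (\<Sum>t\<in>Poly_Mapping.keys p. ratconst (Poly_Mapping.lookup p t) *
          (\<Prod>i\<in>Poly_Mapping.keys t. ratvar i ^ Poly_Mapping.lookup t i))"
      by (simp add: Fract_monomial)
    also have "\<dots> \<in> S"
    proof (intro subfield_sum_closed[OF S] subfield_mult_closed[OF S] subfield_prod_closed[OF S]
        subfield_power_closed[OF S])
      show "ratconst (Poly_Mapping.lookup p t) \<in> S" for t
        using const mpolys_lookup[OF p] by blast
      show "ratvar i \<in> S" if "t \<in> Poly_Mapping.keys p" "i \<in> Poly_Mapping.keys t" for i t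
        using that p var unfolding mpolys_def by blast
    qed
    finally show ?thesis .
  qed
  fix x assume "x \<in> ratfuns F m"
  then obtain p q where x: "x = Fract p q" "p \<in> mpolys F m" "q \<in> mpolys F m"
    unfolding ratfuns_def by blast
  have "x = Fract p 1 * inverse (Fract q 1)" using x by simp
  also have "\<dots> \<in> S" using poly x by (intro subfield_closed[OF S])
  finally show "x \<in> S" .
qed

section \<open>Coefficientwise summability\<close>

theorem theorem3p8:
  fixes F :: "complex set" and n k l :: nat
    and lam :: "nat \<Rightarrow> complex" and \<sigma> :: "ratfun \<Rightarrow> ratfun"
    and \<epsilon> :: complex and a :: ratfun and c :: "nat \<Rightarrow> ratfun"
  assumes "subfield F (ring_of_type_algebra :: complex ring)"
    and "\<forall>z\<in>F. algebraic z"
    and "n \<ge> 1"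
    and "\<forall>i\<in>{1..n}. lam i \<in> F - {0}"
    and "\<sigma> \<in> field_auts (ratfuns F n)"
    and "\<forall>z\<in>F. \<sigma> (ratconst z) = ratconst z"
    and "\<forall>i\<in>{1..n}. \<sigma> (ratvar i) = ratconst (lam i) * ratvar i"
    and "\<epsilon> \<in> F - {0}"
    and "k \<noteq> 0"
    and "\<forall>i\<le>l. c i \<in> ratfuns F (n - 1)"
    and "a = (\<Sum>i\<le>l. c i * ratvar n ^ i)"
  shows "(\<exists>g \<in> poly_elems (ratfuns F (n - 1)) (ratvar n).
            deg_over (ratfuns F (n - 1)) (ratvar n) g \<le> deg_over (ratfuns F (n - 1)) (ratvar n) a \<and>
            a = ratconst \<epsilon> * (\<sigma> ^^ k) g - g)
         \<longleftrightarrow> (\<forall>i\<le>l. summable_in (ratfuns F (n - 1)) \<sigma> k (\<epsilon> * lam n ^ (k * i)) (c i))"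
proof -
  note F = assms(1) and \<sigma> = assms(5)
  define K L where "K = ratfuns F (n - 1)" and "L = ratfuns F n"
  have K: "subfield K (ring_of_type_algebra :: ratfun ring)"
    and L: "subfield L (ring_of_type_algebra :: ratfun ring)"
    unfolding K_def L_def by (rule subfield_ratfuns[OF F])+
  have "K \<subseteq> L" unfolding K_def L_def by (rule ratfuns_mono) auto
  have lam: "lam i \<in> F" if "i \<in> {1..n}" for i using assms(4) that by blast
  have x: "ratvar n \<in> L" unfolding L_def by (rule ratvar_in_ratfuns[OF F]) (use assms(3) in auto)

  \<comment> \<open>The automorphism maps every generator of \<open>K\<close> into \<open>K\<close>, hence all of \<open>K\<close>.\<close>
  have "K \<subseteq> {y \<in> L. \<sigma> y \<in> K}"
    unfolding K_def
  proof (rule ratfuns_least)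
    show "subfield {y \<in> L. \<sigma> y \<in> ratfuns F (n - 1)} (ring_of_type_algebra :: ratfun ring)"
      using subfield_preimage[OF L _ K] \<sigma> by (simp add: K_def L_def)
    show "ratconst ` F \<subseteq> {y \<in> L. \<sigma> y \<in> ratfuns F (n - 1)}"
      using assms(6) ratconst_in_ratfuns[OF F] by (auto simp: L_def)
    show "ratvar ` {1..n - 1} \<subseteq> {y \<in> L. \<sigma> y \<in> ratfuns F (n - 1)}"
    proof safe
      fix i assume i: "i \<in> {1..n - 1}"
      then have n: "i \<in> {1..n}" by auto
      then show "ratvar i \<in> L" by (simp add: L_def ratvar_in_ratfuns[OF F])
      show "\<sigma> (ratvar i) \<in> ratfuns F (n - 1)"
        using assms(7) n i lam[OF n] subfield_mult_closed[OF subfield_ratfuns[OF F]]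
          ratconst_in_ratfuns[OF F] ratvar_in_ratfuns[OF F] by simp
    qed
  qed
  then have \<sigma>K: "(\<sigma> ^^ j) ` K \<subseteq> K" for j
    by (induction j) auto

  have lam_n: "lam n \<in> F" using lam[of n] assms(3) by simp
  have \<sigma>x: "(\<sigma> ^^ j) (ratvar n) = ratconst (lam n ^ j) * ratvar n" for j
  proof (induction j)
    case (Suc j)
    have z: "lam n ^ j \<in> F" using lam_n by (rule subfield_power_closed[OF F])
    have "(\<sigma> ^^ Suc j) (ratvar n) = \<sigma> (ratconst (lam n ^ j)) * \<sigma> (ratvar n)"
      using Suc.IH field_auts_mult[OF \<sigma>] x z by (simp add: ratconst_in_ratfuns[OF F] L_def)
    then show ?case
      using assms(3,6,7) z by (simp add: ratconst_mult)
  qed (simp add: ratconst_one)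

  define p where "p = (\<Sum>i\<le>l. monom (c i) i)"
  have coeff_p: "coeff p i = (if i \<le> l then c i else 0)" for i
    by (simp add: p_def coeff_sum)
  have p: "p \<in> polys_over K"
    using assms(10) subfield_zero_closed[OF K] by (auto simp: polys_over_def coeff_p K_def)
  have a: "poly p (ratvar n) = a"
    by (simp add: p_def poly_sum poly_monom assms(11))
  have "(\<exists>g \<in> poly_elems K (ratvar n). deg_over K (ratvar n) g \<le> deg_over K (ratvar n) a \<and>
            a = ratconst \<epsilon> * (\<sigma> ^^ k) g - g)
      \<longleftrightarrow> (\<forall>i. \<exists>v\<in>K. coeff p i = ratconst \<epsilon> * ratconst (lam n ^ k) ^ i * (\<sigma> ^^ k) v - v)"
    unfolding a[symmetric]
  proof (rule skew_difference_coeffwise[OF L K \<open>K \<subseteq> L\<close> _ \<sigma>K x \<sigma>x])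
    show "\<sigma> ^^ k \<in> field_auts L" using field_auts_funpow[OF \<sigma>] by (simp add: L_def)
    show "ratconst (lam n ^ k) \<in> K" "ratconst \<epsilon> \<in> K"
      using assms(8) lam_n subfield_power_closed[OF F] by (auto simp: K_def intro!: ratconst_in_ratfuns[OF F])
    show "inj_on (\<lambda>p. poly p (ratvar n)) (polys_over K)"
      unfolding K_def by (rule inj_on_poly_ratvar) (use assms(3) in simp)
  qed (rule p)
  also have "\<dots> \<longleftrightarrow> (\<forall>i. \<exists>v\<in>K. coeff p i = ratconst (\<epsilon> * lam n ^ (k * i)) * (\<sigma> ^^ k) v - v)"
    by (simp add: ratconst_mult ratconst_power power_mult)
  also have "\<dots> \<longleftrightarrow> (\<forall>i\<le>l. summable_in K \<sigma> k (\<epsilon> * lam n ^ (k * i)) (c i))"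
  proof -
    have "(\<sigma> ^^ k) 0 = 0"
      using field_auts_zero[OF L] field_auts_funpow[OF \<sigma>] by (simp add: L_def)
    \<comment> \<open>Coefficients beyond \<open>l\<close> vanish and are summable with \<open>v = 0\<close>.\<close>
    then have "\<exists>v\<in>K. 0 = e * (\<sigma> ^^ k) v - v" for e
      using subfield_zero_closed[OF K] by (intro bexI[of _ 0]) auto
    then show ?thesis by (auto simp: coeff_p summable_in_def)
  qed
  finally show ?thesis by (simp add: K_def)
qed

end
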